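(* For every positive integer $n$ and every permutation $w\in S_n$, the Hecke--Grothendieck polynomial $\mathcal{KN}_w^{(\alpha,\beta,\gamma=0)}(\boldsymbol{x};\boldsymbol{0})$ has non-negative coefficients: $$\mathcal{KN}_w^{(\alpha,\beta,\gamma=0)}(\boldsymbol{x};\boldsymbol{0})\in\mathbb{N}[\alpha,\beta][x_1,x_2,\ldots,x_n].$$
   Context: $\mathbb{N}$ denotes the nonnegative integers and $\alpha,\beta,\gamma,x_1,\ldots,x_n$ are indeterminates. Let $\partial_i(f)=\dfrac{f(x_1,\ldots,x_{i-1},x_{i+1},x_i,x_{i+2},\ldots,x_n)-f(x_1,\ldots,x_n)}{x_{i+1}-x_i}$ and, for $1\le i\le n-1$, $$T_i^{(\alpha,\beta,\gamma)}=-\beta+\big((\alpha+\beta+\gamma)x_i+\gamma x_{i+1}+1+(\beta+\gamma)(\alpha+\gamma)x_ix_{i+1}\big)\partial_i .$$ These operators satisfy the braid relations, so $T_w^{(\alpha,\beta,\gamma)}=T_{i_1}^{(\alpha,\beta,\gamma)}\circ\cdots\circ T_{i_\ell}^{(\alpha,\beta,\gamma)}$ is well defined for any reduced decomposition $w=s_{i_1}\cdots s_{i_\ell}\in S_n$. Then $\mathcal{KN}_w^{(\alpha,\beta,\gamma)}(\boldsymbol{x};\boldsymbol{0})=T_w^{(\alpha,\beta,\gamma)}(x_1^{n-1}x_2^{n-2}\cdots x_{n-1})$, and the Hecke--Grothendieck polynomials are the specializations of these at $\gamma=0$. *)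

theory Defs
  imports "HOL-Library.Poly_Mapping" "HOL-Combinatorics.Permutations"
begin

section \<open>Multivariate polynomials\<close>

text \<open>
  The variables are indexed by natural numbers and a monomial is its finitely supported exponent
  function. Thus \<open>int mpoly mpoly\<close> consists of the polynomials in variables
  x over the ring of integer polynomials in the parameters.
\<close>

type_synonym 'a mpoly = "(nat \<Rightarrow>\<^sub>0 nat) \<Rightarrow>\<^sub>0 'a"

definition Const :: "'a::zero \<Rightarrow> 'a mpoly" where
  "Const c = Poly_Mapping.single 0 c"

definition Var :: "nat \<Rightarrow> 'a::zero_neq_one mpoly" where
  "Var v = Poly_Mapping.single (Poly_Mapping.single v 1) 1"

text \<open>Apply \<open>h\<close> to the coefficients and substitute \<open>\<phi> v\<close> for each variable \<open>v\<close>.\<close>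

definition subst :: "('a::zero \<Rightarrow> 'b::comm_semiring_1) \<Rightarrow> (nat \<Rightarrow> 'b) \<Rightarrow> 'a mpoly \<Rightarrow> 'b" where
  "subst h \<phi> p =
     (\<Sum>m\<in>Poly_Mapping.keys p. h (Poly_Mapping.lookup p m) *
        (\<Prod>v\<in>Poly_Mapping.keys m. \<phi> v ^ Poly_Mapping.lookup m v))"

text \<open>For \<open>0 \<in> C\<close>: the polynomials in the variables \<open>V\<close> with all coefficients in \<open>C\<close>.\<close>

definition polys_over :: "'a::zero set \<Rightarrow> nat set \<Rightarrow> 'a mpoly set" where
  "polys_over C V =
     {p. \<forall>m\<in>Poly_Mapping.keys p. Poly_Mapping.lookup p m \<in> C \<and> Poly_Mapping.keys m \<subseteq> V}"

section \<open>Divided differences\<close>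

definition swap_vars :: "nat \<Rightarrow> 'a::comm_semiring_1 mpoly \<Rightarrow> 'a mpoly" where
  "swap_vars i = subst Const (\<lambda>j. Var (transpose i (i + 1) j))"

text \<open>The quotient exists and is unique by \<open>divided_difference_unique\<close> below.\<close>

definition divided_difference :: "nat \<Rightarrow> 'a::idom mpoly \<Rightarrow> 'a mpoly" where
  "divided_difference i f = (THE q. q * (Var (i + 1) - Var i) = swap_vars i f - f)"

lemma Var_power: "(Var v :: 'a::comm_semiring_1 mpoly) ^ k
    = Poly_Mapping.single (Poly_Mapping.single v k) 1"
  by (induction k) (simp_all add: Var_def mult_single flip: single_add)

lemma prod_single_one:
  "finite A \<Longrightarrow> (\<Prod>v\<in>A. Poly_Mapping.single (g v) (1::'a::comm_semiring_1))
     = Poly_Mapping.single (\<Sum>v\<in>A. g v :: nat \<Rightarrow>\<^sub>0 nat) 1"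
  by (induction A rule: finite_induct) (simp_all add: mult_single)

lemma poly_mapping_sum_singles:
  "(\<Sum>m\<in>Poly_Mapping.keys p. Poly_Mapping.single m (Poly_Mapping.lookup p m))
     = (p :: 'b \<Rightarrow>\<^sub>0 'a::comm_monoid_add)"
  by (rule poly_mapping_eqI)
     (auto simp: lookup_sum lookup_single when_def in_keys_iff)

lemma subst_Const_Var: "subst Const Var p = (p :: 'a::comm_semiring_1 mpoly)"
proof -
  have "Const (Poly_Mapping.lookup p m) *
          (\<Prod>v\<in>Poly_Mapping.keys m. Var v ^ Poly_Mapping.lookup m v)
        = Poly_Mapping.single m (Poly_Mapping.lookup p m)" for m
    by (simp add: Var_power prod_single_one Const_def mult_single poly_mapping_sum_singles)
  then show ?thesis
    by (simp add: subst_def poly_mapping_sum_singles)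
qed

lemma dvd_prod_diff:
  fixes d :: "'a::comm_ring_1"
  assumes "finite A" "\<And>v. v \<in> A \<Longrightarrow> d dvd f v - g v"
  shows "d dvd prod f A - prod g A"
  using assms
proof (induction A rule: finite_induct)
  case (insert a A)
  have "prod f (insert a A) - prod g (insert a A)
      = (f a - g a) * prod f A + g a * (prod f A - prod g A)"
    using insert by (simp add: algebra_simps)
  then show ?case using insert by simp
qed simp

lemma dvd_power_diff:
  fixes d :: "'a::comm_ring_1"
  assumes "d dvd a - b"
  shows "d dvd a ^ k - b ^ k"
  using dvd_prod_diff[of "{..<k}" d "\<lambda>_. a" "\<lambda>_. b"] assms by simp

lemma divided_difference_unique:
  "\<exists>!q. q * (Var (i + 1) - Var i) = swap_vars i f - (f :: 'a::idom mpoly)"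
proof -
  let ?d = "Var (i + 1) - Var i :: 'a mpoly"
  have v: "?d dvd Var (transpose i (i + 1) v) - Var v" for v
  proof -
    have "Var i - Var (i + 1) = - ?d"
      by simp
    then have "?d dvd Var i - Var (i + 1)"
      by (metis dvd_minus_iff dvd_refl)
    then show ?thesis
      by (auto simp: transpose_def)
  qed
  have "swap_vars i f - f = swap_vars i f - subst Const Var f"
    by (simp add: subst_Const_Var)
  also have "?d dvd \<dots>"
    unfolding swap_vars_def subst_def sum_subtractf[symmetric] right_diff_distrib[symmetric]
    by (intro dvd_sum dvd_mult dvd_prod_diff dvd_power_diff v) simp
  finally obtain q where q: "swap_vars i f - f = q * ?d"
    by (metis dvdE mult.commute)
  have "Poly_Mapping.lookup ?d (Poly_Mapping.single i 1) = -1"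
  proof -
    have "Poly_Mapping.single (Suc i) 1 \<noteq> Poly_Mapping.single i (1::nat)"
      by (metis lookup_single_eq lookup_single_not_eq n_not_Suc_n zero_neq_one)
    then show ?thesis
      by (simp add: Var_def lookup_minus lookup_single when_def)
  qed
  then have "?d \<noteq> 0"
    by auto
  then show ?thesis
    using q by (metis mult_right_cancel)
qed

section \<open>Reduced decompositions\<close>

definition simple_transp :: "nat \<Rightarrow> nat \<Rightarrow> nat" where
  "simple_transp i = transpose i (i + 1)"

definition is_word :: "nat \<Rightarrow> (nat \<Rightarrow> nat) \<Rightarrow> nat list \<Rightarrow> bool" where
  "is_word n w is \<longleftrightarrow>
     set is \<subseteq> {1..<n} \<and> w = foldr (\<lambda>i u. simple_transp i \<circ> u) is id"

definition reduced_word :: "nat \<Rightarrow> (nat \<Rightarrow> nat) \<Rightarrow> nat list \<Rightarrow> bool" where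
  "reduced_word n w is \<longleftrightarrow> is_arg_min length (is_word n w) is"

lemma is_word_id: "is_word n id []"
  by (simp add: is_word_def)

lemma is_word_append:
  assumes "is_word n u is" "is_word n v js"
  shows "is_word n (u \<circ> v) (is @ js)"
proof -
  have "foldr (\<lambda>i u. simple_transp i \<circ> u) is g
      = foldr (\<lambda>i u. simple_transp i \<circ> u) is id \<circ> g" for g
    by (induction "is") (auto simp: o_assoc)
  from this[of "foldr (\<lambda>i u. simple_transp i \<circ> u) js id"] show ?thesis
    using assms by (auto simp: is_word_def)
qed

lemma is_word_transpose:
  assumes "1 \<le> a" "a + Suc k \<le> n"
  shows "\<exists>is. is_word n (transpose a (a + Suc k)) is"
  using assms(2)
proof (induction k)
  case 0
  then show ?case
    using assms by (intro exI[of _ "[a]"]) (auto simp: is_word_def simple_transp_def)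
next
  case (Suc k)
  let ?b = "a + Suc k"
  obtain "is" where i: "is_word n (transpose a ?b) is"
    using Suc by auto
  have s: "is_word n (transpose ?b (Suc ?b)) [?b]"
    using Suc.prems assms by (auto simp: is_word_def simple_transp_def)
  have "transpose a (Suc ?b) = transpose ?b (Suc ?b) \<circ> transpose a ?b \<circ> transpose ?b (Suc ?b)"
    by (auto simp: fun_eq_iff transpose_def)
  then show ?case
    using is_word_append[OF is_word_append[OF s i] s] by (metis add_Suc_right)
qed

lemma reduced_word_exists:
  assumes "w permutes {1..n}"
  shows "\<exists>is. reduced_word n w is"
proof -
  have "\<exists>is. is_word n w is"
    using assms finite_atLeastAtMost[of 1 n]
  proof (induction rule: permutes_induct)
    case id
    show ?case using is_word_id by blast
  next
    case (swap a b p)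
    have "\<exists>is. is_word n (transpose c d) is" if "c < d" "1 \<le> c" "d \<le> n" for c d
      using is_word_transpose[of c "d - Suc c" n] that by auto
    then have "\<exists>is. is_word n (transpose a b) is"
      using swap by (metis atLeastAtMost_iff linorder_neqE_nat transpose_commute)
    then show ?case
      using swap is_word_append by blast
  qed
  then show ?thesis
    unfolding reduced_word_def by (metis is_arg_min_arg_min_nat)
qed

section \<open>The polynomials\<close>

text \<open>
  The parameters are variables of the coefficient ring; \<open>polys_over \<nat> {0, 1}\<close> is
  therefore the set of polynomials in \<open>alpha\<close> and \<open>beta\<close> with natural coefficients.
\<close>

definition alpha :: "int mpoly" where "alpha = Var 0"
definition beta :: "int mpoly" where "beta = Var 1"
definition gamma :: "int mpoly" where "gamma = Var 2"

definition T_op :: "nat \<Rightarrow> int mpoly mpoly \<Rightarrow> int mpoly mpoly" where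
  "T_op i f =
     - Const beta * f
     + (Const (alpha + beta + gamma) * Var i + Const gamma * Var (i + 1) + 1
        + Const ((beta + gamma) * (alpha + gamma)) * Var i * Var (i + 1))
       * divided_difference i f"

text \<open>
  The operators \<open>T_op i\<close> satisfy the braid relations, so the choice of the reduced word
  is immaterial; one exists by \<open>reduced_word_exists\<close>.
\<close>

definition T_perm :: "nat \<Rightarrow> (nat \<Rightarrow> nat) \<Rightarrow> int mpoly mpoly \<Rightarrow> int mpoly mpoly" where
  "T_perm n w = foldr (\<lambda>i F. T_op i \<circ> F) (SOME is. reduced_word n w is) id"

definition KN :: "nat \<Rightarrow> (nat \<Rightarrow> nat) \<Rightarrow> int mpoly mpoly" where
  "KN n w = T_perm n w (\<Prod>i=1..n. Var i ^ (n - i))"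

definition gamma_to_zero :: "int mpoly mpoly \<Rightarrow> int mpoly mpoly" where
  "gamma_to_zero = subst (\<lambda>c. Const (subst Const (Var(2 := 0)) c)) Var"

definition hecke_grothendieck :: "nat \<Rightarrow> (nat \<Rightarrow> nat) \<Rightarrow> int mpoly mpoly" where
  "hecke_grothendieck n w = gamma_to_zero (KN n w)"

end

theory Submission
  imports Defs
begin

text \<open>
  At \<open>\<gamma> = 0\<close> put \<open>x = x\<^sub>i\<close>, \<open>y = x\<^sub>i\<^sub>+\<^sub>1\<close> and let \<open>s\<close> exchange them. Since
  \<open>1 + (\<alpha> + \<beta>) x + \<alpha> \<beta> x y = (1 + \<alpha> x) (1 + \<beta> y) + \<beta> (x - y)\<close>, the equation \<open>g = T\<^sub>i f\<close> is equivalent to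
    \<open>(1 + (\<alpha> + \<beta>) x + \<alpha> \<beta> x y) \<cdot> s f = (1 + \<alpha> x) (1 + \<beta> y) \<cdot> f + (y - x) \<cdot> g\<close>.
  This is the exchange relation that the Yang--Baxter equation yields for two neighbouring rows of a
  coloured six-vertex model, where \<open>g\<close> comes from \<open>f\<close> by exchanging the colours that enter these rows.

  The model has \<open>n\<close> rows, with row \<open>i\<close> carrying the variable \<open>x\<^sub>i\<close>, and \<open>n\<close> columns. A coloured path
  enters each row from the left, paths move right and up, and the colours leave at the top,
  from left to right, in the order \<open>n, \<dots>, 1\<close>. If row \<open>i\<close> is entered by colour \<open>i\<close>, only one configuration exists, of weight
  \<open>\<Prod>\<^sub>i (1 + \<alpha> x\<^sub>i) x\<^sub>i\<^bsup>n-i\<^esup>\<close> (\<open>partition_function_frozen\<close>). Along a reduced word each operator acts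
  at an ascent of the colouring (\<open>reduced_word_ConsD\<close>), so the exchange relation
  (\<open>yang_baxter_partition_function\<close>) gives by induction
    \<open>\<Prod>\<^sub>i (1 + \<alpha> x\<^sub>i) \<cdot> KN\<^sub>w\<close> = partition function in which colour \<open>w\<^sup>-\<^sup>1(i)\<close> enters row \<open>i\<close>
  (\<open>hecke_word_row_colouring_sum\<close>).

  All weights lie in \<open>\<nat>[\<alpha>, \<beta>, x\<^sub>1, \<dots>, x\<^sub>n]\<close>. Moreover a row starts with a colour on its horizontal line
  and ends with none, so somewhere the line passes from a colour to the empty state, and such
  a vertex has weight \<open>1 + \<alpha> x\<^sub>i\<close>. Each configuration is thus divisible by \<open>\<Prod>\<^sub>i (1 + \<alpha> x\<^sub>i)\<close> with
  a positive quotient (\<open>partition_function_divisible\<close>); cancelling the product proves the theorem.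
\<close>

section \<open>Ring homomorphisms and substitution\<close>

locale semiring_hom =
  fixes f :: "'a::comm_semiring_1 \<Rightarrow> 'b::comm_semiring_1"
  assumes zero [simp]: "f 0 = 0" and one [simp]: "f 1 = 1"
    and add: "f (x + y) = f x + f y" and mult: "f (x * y) = f x * f y"
begin

lemma sum: "f (sum g A) = (\<Sum>a\<in>A. f (g a))"
  by (induction A rule: infinite_finite_induct) (simp_all add: add)

lemma prod: "f (prod g A) = (\<Prod>a\<in>A. f (g a))"
  by (induction A rule: infinite_finite_induct) (simp_all add: mult)

lemma power: "f (x ^ n) = f x ^ n"
  by (induction n) (simp_all add: mult)

lemma subst: "f (subst h \<phi> p) = subst (\<lambda>c. f (h c)) (\<lambda>v. f (\<phi> v)) p"
  by (simp add: subst_def sum mult prod power)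

end

lemma semiring_hom_diff:
  fixes f :: "'a::comm_ring_1 \<Rightarrow> 'b::comm_ring_1"
  assumes "semiring_hom f"
  shows "f (x - y) = f x - f y"
proof -
  interpret semiring_hom f by fact
  have "f (x - y) + f y = f x" by (simp flip: add)
  then show ?thesis by (simp add: eq_diff_eq)
qed

definition monomial_value :: "(nat \<Rightarrow> 'b::comm_semiring_1) \<Rightarrow> (nat \<Rightarrow>\<^sub>0 nat) \<Rightarrow> 'b" where
  "monomial_value \<phi> m = (\<Prod>v\<in>Poly_Mapping.keys m. \<phi> v ^ Poly_Mapping.lookup m v)"

lemma monomial_value_superset:
  assumes "finite A" "Poly_Mapping.keys m \<subseteq> A"
  shows "monomial_value \<phi> m = (\<Prod>v\<in>A. \<phi> v ^ Poly_Mapping.lookup m v)"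
  unfolding monomial_value_def
  by (rule prod.mono_neutral_left[OF assms]) (simp add: in_keys_iff)

lemma monomial_value_add:
  "monomial_value \<phi> (m + k) = monomial_value \<phi> m * monomial_value \<phi> k"
proof -
  let ?A = "Poly_Mapping.keys m \<union> Poly_Mapping.keys k"
  have "Poly_Mapping.keys (m + k) \<subseteq> ?A" by (rule keys_add)
  then show ?thesis
    by (simp add: monomial_value_superset[of ?A] lookup_add power_add prod.distrib)
qed

lemma subst_superset:
  assumes "h 0 = 0" "finite A" "Poly_Mapping.keys p \<subseteq> A"
  shows "subst h \<phi> p = (\<Sum>m\<in>A. h (Poly_Mapping.lookup p m) * monomial_value \<phi> m)"
  unfolding subst_def monomial_value_def
  by (rule sum.mono_neutral_left[OF assms(2,3)]) (simp add: in_keys_iff assms(1))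

lemma subst_single:
  "h 0 = 0 \<Longrightarrow> subst h \<phi> (Poly_Mapping.single m c) = h c * monomial_value \<phi> m"
  by (simp add: subst_superset[of h "{m}"])

lemma mult_sum_singles:
  fixes p q :: "'a::comm_semiring_1 mpoly"
  shows "p * q = (\<Sum>m\<in>Poly_Mapping.keys p. \<Sum>k\<in>Poly_Mapping.keys q.
    Poly_Mapping.single (m + k) (Poly_Mapping.lookup p m * Poly_Mapping.lookup q k))"
proof -
  have "p * q = (\<Sum>m\<in>Poly_Mapping.keys p. Poly_Mapping.single m (Poly_Mapping.lookup p m))
     * (\<Sum>m\<in>Poly_Mapping.keys q. Poly_Mapping.single m (Poly_Mapping.lookup q m))"
    by (simp only: poly_mapping_sum_singles)
  then show ?thesis by (simp add: sum_product mult_single)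
qed

lemma semiring_hom_subst:
  assumes "semiring_hom h"
  shows "semiring_hom (subst h \<phi>)"
proof -
  interpret h: semiring_hom h by fact
  have add: "subst h \<phi> (p + q) = subst h \<phi> p + subst h \<phi> q" for p q
  proof -
    let ?A = "Poly_Mapping.keys p \<union> Poly_Mapping.keys q"
    have "Poly_Mapping.keys (p + q) \<subseteq> ?A" by (rule keys_add)
    then show ?thesis
      by (simp add: subst_superset[of h ?A] lookup_add h.add distrib_right sum.distrib)
  qed
  have zero: "subst h \<phi> 0 = 0" by (simp add: subst_def)
  have sum: "subst h \<phi> (sum g A) = (\<Sum>a\<in>A. subst h \<phi> (g a))" for g :: "(nat \<Rightarrow>\<^sub>0 nat) \<Rightarrow> _" and A
    by (induction A rule: infinite_finite_induct) (simp_all add: add zero)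
  have "subst h \<phi> (p * q) = (\<Sum>m\<in>Poly_Mapping.keys p. \<Sum>k\<in>Poly_Mapping.keys q.
      h (Poly_Mapping.lookup p m * Poly_Mapping.lookup q k) * monomial_value \<phi> (m + k))" for p q
    by (simp add: mult_sum_singles[of p q] sum subst_single)
  also have "\<dots> p q = subst h \<phi> p * subst h \<phi> q" for p q
    by (simp add: subst_def sum_product h.mult monomial_value_add mult_ac
        flip: monomial_value_def)
  finally have mult: "subst h \<phi> (p * q) = subst h \<phi> p * subst h \<phi> q" for p q .
  have one: "subst h \<phi> 1 = 1"
    by (simp add: subst_single monomial_value_def flip: single_one)
  show ?thesis by standard (simp_all add: add mult zero one)
qed

lemma subst_Var: "h 0 = 0 \<Longrightarrow> h 1 = 1 \<Longrightarrow> subst h \<phi> (Var v) = \<phi> v"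
  by (simp add: Var_def subst_single monomial_value_def)

lemma subst_Const: "h 0 = 0 \<Longrightarrow> subst h \<phi> (Const c) = h c"
  by (simp add: Const_def subst_single monomial_value_def)

lemma semiring_hom_Const: "semiring_hom Const"
  by standard (simp_all add: Const_def single_add mult_single)

lemma semiring_hom_comp:
  "semiring_hom f \<Longrightarrow> semiring_hom g \<Longrightarrow> semiring_hom (\<lambda>x. f (g x))"
  by (simp add: semiring_hom_def)

section \<open>Polynomials with coefficients in a subsemiring\<close>

lemma zero_in_polys_over: "0 \<in> polys_over C V"
  by (simp add: polys_over_def)

lemma polys_over_add:
  fixes C :: "'a::comm_monoid_add set"
  assumes "0 \<in> C" "\<And>c d. c \<in> C \<Longrightarrow> d \<in> C \<Longrightarrow> c + d \<in> C"
    and "p \<in> polys_over C V" "q \<in> polys_over C V"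
  shows "p + q \<in> polys_over C V"
proof -
  have *: "Poly_Mapping.lookup r m \<in> C" if "r \<in> polys_over C V" for r m
    using that assms(1) by (cases "m \<in> Poly_Mapping.keys r") (auto simp: polys_over_def in_keys_iff)
  show ?thesis
    using assms(3,4) keys_add[of p q] *[OF assms(3)] *[OF assms(4)]
    by (auto simp: polys_over_def lookup_add assms(2))
qed

lemma polys_over_single:
  "c \<in> C \<Longrightarrow> Poly_Mapping.keys m \<subseteq> V \<Longrightarrow> Poly_Mapping.single m c \<in> polys_over C V"
  by (auto simp: polys_over_def)

lemma polys_over_mult:
  fixes C :: "'a::comm_semiring_1 set"
  assumes "0 \<in> C" "\<And>c d. c \<in> C \<Longrightarrow> d \<in> C \<Longrightarrow> c + d \<in> C" "\<And>c d. c \<in> C \<Longrightarrow> d \<in> C \<Longrightarrow> c * d \<in> C"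
    and "p \<in> polys_over C V" "q \<in> polys_over C V"
  shows "p * q \<in> polys_over C V"
proof -
  have sum: "(\<And>a. a \<in> A \<Longrightarrow> g a \<in> polys_over C V) \<Longrightarrow> sum g A \<in> polys_over C V"
    for g :: "(nat \<Rightarrow>\<^sub>0 nat) \<Rightarrow> _" and A
    by (induction A rule: infinite_finite_induct)
       (simp_all add: zero_in_polys_over polys_over_add assms(1,2))
  show ?thesis
    unfolding mult_sum_singles[of p q]
    using assms(4,5) keys_add by (intro sum polys_over_single) (fastforce simp: polys_over_def assms(3))+
qed

lemma one_in_polys_over: "1 \<in> C \<Longrightarrow> 1 \<in> polys_over C V"
  using polys_over_single[of 1 C 0 V] by simp

lemma Var_in_polys_over: "1 \<in> C \<Longrightarrow> v \<in> V \<Longrightarrow> Var v \<in> polys_over C V"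
  unfolding Var_def by (rule polys_over_single) auto

lemma Const_in_polys_over: "c \<in> C \<Longrightarrow> Const c \<in> polys_over C V"
  unfolding Const_def by (rule polys_over_single) auto

lemma Const_mult_Var: "Const c * Var i = Poly_Mapping.single (Poly_Mapping.single i 1) (c::'a::comm_semiring_1)"
  by (simp add: Const_def Var_def mult_single)

lemma Var_diff_nonzero: "(Var (i + 1) - Var i :: 'a::comm_ring_1 mpoly) \<noteq> 0"
proof -
  have "Poly_Mapping.single (Suc i) (1::nat) \<noteq> Poly_Mapping.single i 1"
    by (metis lookup_single_eq lookup_single_not_eq n_not_Suc_n zero_neq_one)
  then have "Poly_Mapping.lookup (Var (i + 1) - Var i :: 'a mpoly) (Poly_Mapping.single i 1) = - 1"
    by (simp add: Var_def lookup_minus lookup_single when_def)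
  then show ?thesis by auto
qed

lemma one_plus_Var_nonzero: "(1 + Const c * Var i :: 'a::comm_semiring_1 mpoly) \<noteq> 0"
proof -
  have "Poly_Mapping.single i (1::nat) \<noteq> 0"
    by (metis lookup_single_eq lookup_zero zero_neq_one)
  then have "Poly_Mapping.lookup (1 + Const c * Var i :: 'a mpoly) 0 = 1"
    by (simp add: Const_mult_Var lookup_add lookup_one lookup_single)
  then show ?thesis by auto
qed

section \<open>A coloured six-vertex model\<close>

text \<open>
  Colours are \<open>1, \<dots>, K\<close>; the number \<open>0\<close> marks an empty edge and takes part in the order of the colours.
\<close>

locale six_vertex =
  fixes K :: nat and \<alpha> \<beta> :: "'a::comm_ring_1"
begin

text \<open>
  The factor by which a horizontal line of colour \<open>a\<close> crosses a vertical line of colour \<open>b\<close>, up to the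
  row variable. In the present coordinate the \<open>R\<close>-matrix of the quantum affine algebra gives \<open>- \<beta>\<close> and \<open>- \<alpha>\<close> instead of
  \<open>1\<close> and \<open>\<alpha> \<beta>\<close>. A twist that multiplies opposite crossings by inverse factors keeps the
  Yang--Baxter equation, and the factor \<open>- 1 / \<beta>\<close> makes both weights positive.
  The value \<open>0\<close> for equal colours avoids a case distinction below.
\<close>

definition through :: "nat \<Rightarrow> nat \<Rightarrow> 'a" where
  "through a b = (if a < b then 1 else if b < a then \<alpha> * \<beta> else 0)"

text \<open>
  The weight of a vertex whose left and top edges have colour \<open>a\<close> and whose bottom and right edges
  have colour \<open>b\<close>.
\<close>

definition turn :: "'a \<Rightarrow> nat \<Rightarrow> nat \<Rightarrow> 'a" where
  "turn x a b = (if a < b then 1 + \<beta> * x else if b < a then 1 + \<alpha> * x else 1)"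

text \<open>
  The transfer operator of a row with variable \<open>x\<close>: \<open>\<phi>\<close> weighs the colours below the row, the last
  argument lists the colours above it from left to right, \<open>a\<close> enters from the left and the right
  end is empty. A vertex preserves colours. So if the top edge \<open>w\<close> differs from \<open>a\<close>, both lines go straight;
  if \<open>w = a\<close>, the bottom colour \<open>v\<close> is free and continues to the right.
\<close>

fun row_op :: "'a \<Rightarrow> nat \<Rightarrow> (nat list \<Rightarrow> 'a) \<Rightarrow> nat list \<Rightarrow> 'a" where
  "row_op x a \<phi> [] = (if a = 0 then \<phi> [] else 0)"
| "row_op x a \<phi> (w # ws) =
     through a w * x * row_op x a (\<lambda>vs. \<phi> (w # vs)) ws
     + (if w = a then \<Sum>v\<le>K. turn x a v * row_op x v (\<lambda>vs. \<phi> (v # vs)) ws else 0)"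

lemma row_op_add:
  "row_op x a (\<lambda>vs. \<phi> vs + \<psi> vs) ws = row_op x a \<phi> ws + row_op x a \<psi> ws"
  by (induction ws arbitrary: a \<phi> \<psi>) (auto simp: algebra_simps sum.distrib)

lemma row_op_scale: "row_op x a (\<lambda>vs. c * \<phi> vs) ws = c * row_op x a \<phi> ws"
  by (induction ws arbitrary: a \<phi>) (auto simp: algebra_simps sum_distrib_left)

lemma row_op_zero: "row_op x a (\<lambda>vs. 0) ws = 0"
  using row_op_scale[of x a 0] by simp

lemma row_op_sum:
  "row_op x a (\<lambda>vs. \<Sum>v\<in>A. \<phi> v vs) ws = (\<Sum>v\<in>A. row_op x a (\<phi> v) ws)"
  by (induction A rule: infinite_finite_induct) (simp_all add: row_op_zero row_op_add)

text \<open>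
  Weights of the diagonal vertex at which two rows with variables \<open>x\<close> (above) and \<open>y\<close> (below) cross.
  The vertex of two equal colours has weight \<open>cross_same x y\<close>; for \<open>y = 0\<close> the weights are those of
  the lattice vertices.
\<close>

definition cross_same :: "'a \<Rightarrow> 'a \<Rightarrow> 'a" where
  "cross_same x y = 1 + (\<alpha> + \<beta>) * y + \<alpha> * \<beta> * x * y"

definition cross_turn :: "'a \<Rightarrow> 'a \<Rightarrow> nat \<Rightarrow> nat \<Rightarrow> 'a" where
  "cross_turn x y a b = (if a < b then (1 + \<alpha> * y) * (1 + \<beta> * x)
     else if b < a then (1 + \<beta> * y) * (1 + \<alpha> * x) else cross_same x y)"

text \<open>
  The first column of a pair of rows. Given the colours on the left and at the top, colour
  preservation leaves at most two ways to fill the column for each bottom colour, so a single sum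
  over the bottom colour suffices.
\<close>

lemma two_rows_Cons:
  assumes "b \<le> K"
  shows "row_op x a (row_op y b \<phi>) (w # ws) =
    through a w * x * through b w * y * row_op x a (row_op y b (\<lambda>vs. \<phi> (w # vs))) ws
    + (\<Sum>v\<le>K. (if w = b then through a w * x * turn y b v *
          row_op x a (row_op y v (\<lambda>vs. \<phi> (v # vs))) ws else 0)
      + (if w = a then turn x a v * through b v * y *
          row_op x v (row_op y b (\<lambda>vs. \<phi> (v # vs))) ws
        + turn x a b * turn y b v * row_op x b (row_op y v (\<lambda>vs. \<phi> (v # vs))) ws else 0))"
proof -
  have B: "row_op x c (\<lambda>vs. row_op y b \<phi> (v # vs)) ws =
      through b v * y * row_op x c (row_op y b (\<lambda>vs. \<phi> (v # vs))) ws
      + (if v = b then \<Sum>u\<le>K. turn y b u * row_op x c (row_op y u (\<lambda>vs. \<phi> (u # vs))) ws else 0)"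
    for c v
    by (simp add: row_op_add row_op_scale row_op_sum row_op_zero)
  have D: "(\<Sum>v\<le>K. turn x a v * (if v = b then f v else 0)) = turn x a b * f b" for f
    using assms by (subst sum.remove[of _ b]) (auto intro!: sum.neutral)
  show ?thesis
    unfolding row_op.simps(2)[of x a "row_op y b \<phi>"] B
    by (auto simp: sum.distrib distrib_left D sum_distrib_left mult.assoc simp del: row_op.simps(2))
qed

text \<open>
  The two ways in which colours \<open>a\<close> and \<open>b\<close> leave the diagonal vertex: they go straight or they turn.
\<close>

definition cross_sum :: "'a \<Rightarrow> 'a \<Rightarrow> (nat \<Rightarrow> nat \<Rightarrow> 'a) \<Rightarrow> nat \<Rightarrow> nat \<Rightarrow> 'a" where
  "cross_sum x y P a b = through a b * (x - y) * P b a + cross_turn x y a b * P a b"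

text \<open>
  The summand of \<open>two_rows_Cons\<close> with bottom colour \<open>v\<close>, with the columns to the right abstracted
  to a function \<open>P\<close> of the colours that enter them.
\<close>

definition column_term :: "'a \<Rightarrow> 'a \<Rightarrow> nat \<Rightarrow> nat \<Rightarrow> (nat \<Rightarrow> nat \<Rightarrow> 'a) \<Rightarrow> nat \<Rightarrow> nat \<Rightarrow> 'a" where
  "column_term x y w v P a b =
     (if w = b then through a w * x * turn y b v * P a v else 0)
      + (if w = a then turn x a v * through b v * y * P v b
        + turn x a b * turn y b v * P b v else 0)"

text \<open>
  The Yang--Baxter equation: the diagonal vertex may be moved through one column. It depends
  only on the relative order of the colours involved, so finitely many polynomial identities
  remain.
\<close>

lemma yang_baxter_vertex:
  "column_term x y w v (cross_sum x y P) a b = cross_sum x y (column_term y x w v P) a b"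
proof -
  consider "w \<noteq> a" "w \<noteq> b" | "w = b" "a \<noteq> b" | "w = a" "a \<noteq> b" | "w = a" "a = b" by blast
  then show ?thesis
  proof cases
    case 1 then show ?thesis by (simp add: column_term_def cross_sum_def)
  next
    case 2
    then show ?thesis
      by (cases a b rule: linorder_cases; cases a v rule: linorder_cases; cases b v rule: linorder_cases;
          simp add: column_term_def cross_sum_def cross_same_def cross_turn_def through_def turn_def algebra_simps)
  next
    case 3
    then show ?thesis
      by (cases a b rule: linorder_cases; cases a v rule: linorder_cases; cases b v rule: linorder_cases;
          simp add: column_term_def cross_sum_def cross_same_def cross_turn_def through_def turn_def algebra_simps)
  next
    case 4
    then show ?thesis
      by (cases a v rule: linorder_cases;
          simp add: column_term_def cross_sum_def cross_same_def cross_turn_def through_def turn_def algebra_simps)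
  qed
qed

text \<open>
  Moving the diagonal vertex through all columns. At the right end it meets two empty lines
  and contributes \<open>cross_same x y\<close>.
\<close>

lemma yang_baxter_rows:
  assumes "a \<le> K" "b \<le> K"
  shows "cross_same x y * row_op x a (row_op y b \<phi>) ws =
    cross_sum x y (\<lambda>p q. row_op y p (row_op x q \<phi>) ws) a b"
  using assms
proof (induction ws arbitrary: a b \<phi>)
  case Nil
  then show ?case by (auto simp: cross_sum_def through_def cross_turn_def)
next
  case (Cons w ws)
  define P where "P v = (\<lambda>p q. row_op x p (row_op y q (\<lambda>vs. \<phi> (v # vs))) ws)" for v
  define Q where "Q v = (\<lambda>p q. row_op y p (row_op x q (\<lambda>vs. \<phi> (v # vs))) ws)" for v
  have IH: "cross_same x y * P v p q = cross_sum x y (Q v) p q" if "p \<le> K" "q \<le> K" for v p q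
    unfolding P_def Q_def using Cons.IH that .
  have P: "row_op x p (row_op y q \<phi>) (w # ws) =
      through p w * x * through q w * y * P w p q + (\<Sum>v\<le>K. column_term x y w v (P v) p q)"
    if "q \<le> K" for p q
    unfolding P_def column_term_def by (rule two_rows_Cons[OF that])
  have Q: "row_op y p (row_op x q \<phi>) (w # ws) =
      through p w * y * through q w * x * Q w p q + (\<Sum>v\<le>K. column_term y x w v (Q v) p q)"
    if "q \<le> K" for p q
    unfolding Q_def column_term_def by (rule two_rows_Cons[OF that])
  have "cross_same x y * (through a w * x * through b w * y * P w a b)
      = through a w * x * through b w * y * cross_sum x y (Q w) a b"
    by (simp add: IH[symmetric] Cons.prems mult_ac)
  also have "\<dots> = cross_sum x y (\<lambda>p q. through p w * y * through q w * x * Q w p q) a b"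
    by (simp add: cross_sum_def algebra_simps)
  finally have 1: "cross_same x y * (through a w * x * through b w * y * P w a b) = \<dots>" .
  have "cross_same x y * column_term x y w v (P v) a b
      = cross_sum x y (column_term y x w v (Q v)) a b" if "v \<le> K" for v
  proof -
    have "cross_same x y * column_term x y w v (P v) a b
        = column_term x y w v (\<lambda>p q. cross_same x y * P v p q) a b"
      by (simp add: column_term_def algebra_simps)
    also have "\<dots> = column_term x y w v (cross_sum x y (Q v)) a b"
      using that Cons.prems by (simp add: column_term_def IH)
    finally show ?thesis by (simp add: yang_baxter_vertex)
  qed
  then have 2: "cross_same x y * (\<Sum>v\<le>K. column_term x y w v (P v) a b)
      = cross_sum x y (\<lambda>p q. \<Sum>v\<le>K. column_term y x w v (Q v) p q) a b"
    by (simp add: sum_distrib_left cross_sum_def sum.distrib)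
  show ?case
    unfolding P[OF Cons.prems(2)] distrib_left 1 2
    by (simp add: cross_sum_def P Q Cons.prems distrib_left del: row_op.simps(2))
qed

section \<open>Partition functions: exchange, frozen state, divisibility\<close>

lemma cross_sum_row_op:
  "cross_sum x y (\<lambda>p q. row_op z c (P p q) ws) a b = row_op z c (\<lambda>vs. cross_sum x y (\<lambda>p q. P p q vs) a b) ws"
  by (simp add: cross_sum_def row_op_add row_op_scale)

text \<open>
  The first list entries belong to the top row; below the bottom row all vertical edges are empty.
\<close>

fun partition_function :: "'a list \<Rightarrow> nat list \<Rightarrow> nat list \<Rightarrow> 'a" where
  "partition_function (x # xs) (c # cs) = row_op x c (partition_function xs cs)"
| "partition_function _ _ = (\<lambda>ws. if set ws \<subseteq> {0} then 1 else 0)"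

lemma yang_baxter_partition_function:
  assumes "a \<le> K" "b \<le> K" "length xs = length cs"
  shows "cross_same x y * partition_function (xs @ x # y # ys) (cs @ a # b # ds) ws =
    cross_sum x y (\<lambda>p q. partition_function (xs @ y # x # ys) (cs @ p # q # ds) ws) a b"
  using assms(3)
proof (induction xs cs arbitrary: ws rule: list_induct2)
  case Nil
  then show ?case using assms by (simp add: yang_baxter_rows)
next
  case (Cons z zs c cs)
  show ?case
    unfolding append_Cons partition_function.simps(1) row_op_scale[symmetric] Cons.IH cross_sum_row_op ..
qed

text \<open>
  With no colour to leave at the top, a colour on the horizontal line could never leave the row.
\<close>

lemma row_op_zeros:
  "row_op x a \<phi> (replicate k 0) = (if a = 0 then \<phi> (replicate k 0) else 0)"
proof (induction k arbitrary: a \<phi>)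
  case (Suc k)
  have "(\<Sum>v\<le>K. turn x 0 v * (if v = 0 then f v else 0)) = f 0" for f
    by (subst sum.remove[of _ 0]) (auto simp: turn_def through_def intro!: sum.neutral)
  then show ?case by (simp add: Suc through_def)
qed simp

text \<open>
  Entering from the left, the smallest colour has to cross all columns reserved for larger colours and
  to leave in its own column; after that the row stays empty.
\<close>

lemma row_op_frozen:
  assumes "0 < a" "\<forall>u\<in>set us. a < u"
  shows "row_op x a \<phi> (us @ a # replicate k 0) =
    x ^ length us * (1 + \<alpha> * x) * \<phi> (us @ 0 # replicate k 0)"
  using assms(2)
proof (induction us arbitrary: \<phi>)
  case Nil
  have "(\<Sum>v\<le>K. turn x a v * (if v = 0 then f v else 0)) = (1 + \<alpha> * x) * f 0" for f
    using \<open>0 < a\<close> by (subst sum.remove[of _ 0]) (auto simp: turn_def intro!: sum.neutral)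
  then show ?case by (simp add: row_op_zeros through_def)
next
  case (Cons u us)
  then have "a < u" by simp
  then show ?case using Cons by (auto simp: through_def mult_ac)
qed

text \<open>
  Here row \<open>i\<close> is entered by colour \<open>i\<close>. Since the top row removes its colour from the columns, the statement
  for a general lowest colour \<open>m\<close> is proved by adding rows at the top.
\<close>

lemma partition_function_frozen:
  assumes "1 \<le> m" "m \<le> Suc n"
  shows "partition_function (map X [m..<Suc n]) [m..<Suc n] (rev [m..<Suc n] @ replicate (m - 1) 0) =
    (\<Prod>i=m..n. 1 + \<alpha> * X i) * (\<Prod>i=m..n. X i ^ (n - i))"
  using assms(2,1)
proof (induction m rule: inc_induct)
  case base
  then show ?case by auto
next
  case (step m)
  have l: "[m..<Suc n] = m # [Suc m..<Suc n]" using step by (simp add: upt_conv_Cons del: upt_Suc)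
  have s: "{m..n} = insert m {Suc m..n}" using step by auto
  have k: "0 # replicate (m - 1) 0 = replicate (Suc m - 1) (0::nat)"
    using step by (cases m) auto
  have "partition_function (map X [m..<Suc n]) [m..<Suc n] (rev [m..<Suc n] @ replicate (m - 1) 0)
     = X m ^ (n - m) * (1 + \<alpha> * X m) * partition_function (map X [Suc m..<Suc n]) [Suc m..<Suc n]
         (rev [Suc m..<Suc n] @ 0 # replicate (m - 1) 0)"
    unfolding l using step by (simp add: row_op_frozen del: upt_Suc)
  also have "\<dots> = (1 + \<alpha> * X m) * (\<Prod>i=Suc m..n. 1 + \<alpha> * X i)
      * (X m ^ (n - m) * (\<Prod>i=Suc m..n. X i ^ (n - i)))"
    unfolding k using step by (simp add: mult_ac del: upt_Suc)
  finally show ?case unfolding s by simp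
qed

text \<open>
  The set \<open>P\<close> plays the role of the polynomials with natural coefficients.
\<close>

context
  fixes P :: "'a set"
  assumes P0: "0 \<in> P" and P1: "1 \<in> P"
    and Padd: "\<And>p q. p \<in> P \<Longrightarrow> q \<in> P \<Longrightarrow> p + q \<in> P"
    and Pmult: "\<And>p q. p \<in> P \<Longrightarrow> q \<in> P \<Longrightarrow> p * q \<in> P"
    and params: "\<alpha> \<in> P" "\<beta> \<in> P"
begin

lemma P_sum: "(\<And>v. v \<in> A \<Longrightarrow> f v \<in> P) \<Longrightarrow> sum f A \<in> P"
  by (induction A rule: infinite_finite_induct) (auto simp: P0 Padd)

text \<open>
  If the row is entered by a colour, then at some vertex the horizontal line passes from a colour
  \<open>a > 0\<close> to \<open>0\<close>, with weight \<open>turn x a 0 = 1 + \<alpha> x\<close>. The induction runs from left to right and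
  collects this factor at the first such vertex. The factor \<open>D\<close> is what the rows below have already
  contributed.
\<close>

lemma row_op_divisible:
  assumes "x \<in> P" "\<And>vs. \<exists>p\<in>P. \<phi> vs = D * p"
  shows "\<exists>p\<in>P. row_op x a \<phi> ws = (if a = 0 then 1 else 1 + \<alpha> * x) * D * p"
proof -
  define d where "d a = (if a = 0 then 1 else 1 + \<alpha> * x)" for a :: nat
  \<comment> \<open>A turn from \<open>a > 0\<close> to \<open>0\<close> is the required factor itself; a turn to another colour leaves
    the factor to the columns further right.\<close>
  have t: "\<exists>p\<in>P. turn x a v * d v = d a * p" for a v
  proof (cases "a = 0 \<or> v \<noteq> 0")
    case True
    have "turn x a v \<in> P" "d v \<in> P"
      using assms(1) params by (auto simp: turn_def d_def P1 Padd Pmult)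
    then show ?thesis
      using True by (intro bexI[of _ "if a = 0 then turn x a v * d v else turn x a v"])
        (auto simp: Pmult d_def mult.commute)
  next
    case False
    then show ?thesis by (intro bexI[of _ 1]) (auto simp: turn_def d_def P1)
  qed
  have "\<exists>p\<in>P. row_op x a \<phi> ws = d a * D * p"
    using assms(2)
  proof (induction ws arbitrary: a \<phi>)
    case Nil
    show ?case
    proof (cases "a = 0")
      case True then show ?thesis using Nil by (simp add: d_def)
    next
      case False then show ?thesis by (intro bexI[of _ 0]) (simp_all add: P0)
    qed
  next
    case (Cons w ws)
    have "\<exists>p\<in>P. row_op x v (\<lambda>vs. \<phi> (u # vs)) ws = d v * D * p" for u v
      by (rule Cons.IH) (rule Cons.prems)
    then have "\<exists>f. \<forall>u v. f u v \<in> P \<and> row_op x v (\<lambda>vs. \<phi> (u # vs)) ws = d v * D * f u v"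
      by (intro choice allI) blast
    then obtain f where f: "f u v \<in> P" "row_op x v (\<lambda>vs. \<phi> (u # vs)) ws = d v * D * f u v" for u v
      by blast
    have "\<exists>g. \<forall>v. g v \<in> P \<and> turn x a v * d v = d a * g v"
      using t by (intro choice) blast
    then obtain g where g: "g v \<in> P" "turn x a v * d v = d a * g v" for v by blast
    have g': "turn x a v * (d v * D * q) = d a * D * (g v * q)" for v q
      using arg_cong[OF g(2)[of v], of "\<lambda>z. z * (D * q)"] by (simp add: mult_ac)
    have "through a w \<in> P" by (simp add: through_def P0 P1 Pmult params)
    then have "through a w * x * f w a + (if w = a then \<Sum>v\<le>K. g v * f v v else 0) \<in> P"
      using assms(1) f g by (simp add: Padd Pmult P_sum P0)
    moreover have "row_op x a \<phi> (w # ws) = d a * D *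
        (through a w * x * f w a + (if w = a then \<Sum>v\<le>K. g v * f v v else 0))"
      unfolding row_op.simps(2) f(2) g' sum_distrib_left[symmetric] by (simp add: algebra_simps)
    ultimately show ?case by blast
  qed
  then show ?thesis by (simp add: d_def)
qed

lemma partition_function_divisible:
  assumes "set xs \<subseteq> P" "0 \<notin> set cs" "length xs = length cs"
  shows "\<exists>p\<in>P. partition_function xs cs ws = (\<Prod>x\<leftarrow>xs. 1 + \<alpha> * x) * p"
  using assms(3,1,2)
proof (induction xs cs arbitrary: ws rule: list_induct2)
  case Nil
  then show ?case by (simp add: P0 P1)
next
  case (Cons x xs c cs)
  then have "\<exists>p\<in>P. partition_function xs cs vs = (\<Prod>x\<leftarrow>xs. 1 + \<alpha> * x) * p" for vs by simp
  from row_op_divisible[OF _ this, where x = x and a = c and ws = ws] show ?case using Cons.prems by auto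
qed

end

end

context
  fixes f :: "'a::comm_ring_1 \<Rightarrow> 'b::comm_ring_1"
  assumes hom: "semiring_hom f"
begin

interpretation semiring_hom f by (fact hom)

lemma hom_through: "f (six_vertex.through \<alpha> \<beta> a b) = six_vertex.through (f \<alpha>) (f \<beta>) a b"
  by (simp add: six_vertex.through_def mult)

lemma hom_turn: "f (six_vertex.turn \<alpha> \<beta> x a b) = six_vertex.turn (f \<alpha>) (f \<beta>) (f x) a b"
  by (simp add: six_vertex.turn_def add mult)

lemma hom_row_op:
  "f (six_vertex.row_op K \<alpha> \<beta> x a \<phi> ws) =
    six_vertex.row_op K (f \<alpha>) (f \<beta>) (f x) a (\<lambda>vs. f (\<phi> vs)) ws"
  by (induction ws arbitrary: a \<phi>)
     (simp_all add: six_vertex.row_op.simps add mult sum hom_through hom_turn)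

text \<open>
  In particular, swapping two variables of the polynomial ring swaps the variables of two rows.
\<close>

lemma hom_partition_function:
  "f (six_vertex.partition_function K \<alpha> \<beta> xs cs ws) =
    six_vertex.partition_function K (f \<alpha>) (f \<beta>) (map f xs) cs ws"
  by (induction xs cs arbitrary: ws rule: six_vertex.partition_function.induct)
     (simp_all add: six_vertex.partition_function.simps hom_row_op)

end

section \<open>Descents of reduced words\<close>

lemma is_word_Cons:
  "is_word n u (i # is) \<longleftrightarrow> i \<in> {1..<n} \<and> is_word n (simple_transp i \<circ> u) is"
proof -
  have "simple_transp i \<circ> (simple_transp i \<circ> f) = f" for f
    by (auto simp: simple_transp_def fun_eq_iff)
  then have "(u = simple_transp i \<circ> f) = (simple_transp i \<circ> u = f)" for f
    by auto
  from this[of "foldr (\<lambda>i u. simple_transp i \<circ> u) is id"] show ?thesis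
    by (simp add: is_word_def conj_assoc)
qed

lemma is_word_permutes: "is_word n u is \<Longrightarrow> u permutes {1..n}"
proof (induction "is" arbitrary: u)
  case Nil
  then show ?case by (simp add: is_word_def permutes_id id_def[symmetric])
next
  case (Cons i "is")
  have "simple_transp i permutes {1..n}"
    using Cons.prems unfolding is_word_Cons simple_transp_def by (intro permutes_swap_id) auto
  moreover have "simple_transp i \<circ> u permutes {1..n}"
    using Cons unfolding is_word_Cons by blast
  ultimately have "simple_transp i \<circ> (simple_transp i \<circ> u) permutes {1..n}"
    by (rule permutes_compose[rotated])
  moreover have "simple_transp i \<circ> (simple_transp i \<circ> u) = u"
    by (auto simp: simple_transp_def fun_eq_iff)
  ultimately show ?case by simp
qed

text \<open>
  The exchange property. Reading the word from the left, the reflection \<open>transpose a b\<close> is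
  conjugated by each letter passed. As \<open>a\<close> and \<open>b\<close> are inverted in \<open>u\<close>, at some letter \<open>j\<close> the conjugate is
  the simple transposition \<open>j\<close> itself, and this letter can be deleted. Only for that letter can the order of
  the two conjugated points change, so the inequalities survive until then.
\<close>

lemma transposition_exchange:
  assumes "is_word n u is" "a < b" "inv u b < inv u a"
  shows "\<exists>js. is_word n (transpose a b \<circ> u) js \<and> length js < length is"
  using assms
proof (induction "is" arbitrary: u a b)
  case Nil
  then show ?case by (simp add: is_word_def)
next
  case (Cons j "is")
  let ?s = "simple_transp j"
  define v where "v = ?s \<circ> u"
  have j: "j \<in> {1..<n}" and v: "is_word n v is"
    using Cons.prems(1) by (simp_all add: is_word_Cons v_def)
  have ss: "?s (?s x) = x" for x by (simp add: simple_transp_def)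
  have u: "u = ?s \<circ> v" by (auto simp: v_def ss fun_eq_iff)
  show ?case
  proof (cases "a = j \<and> b = j + 1")
    case True
    then show ?thesis using v by (intro exI[of _ "is"]) (simp add: v_def simple_transp_def comp_def)
  next
    case False
    have lt: "?s a < ?s b"
      using \<open>a < b\<close> False by (auto simp: simple_transp_def transpose_def)
    have bij: "bij v" "bij ?s"
      using is_word_permutes[OF v] permutes_bij by (auto simp: simple_transp_def)
    have "inv u x = inv v (?s x)" for x
      unfolding u o_inv_distrib[OF bij(2,1)] by (simp add: simple_transp_def)
    then have "inv v (?s b) < inv v (?s a)" using Cons.prems(3) by simp
    from Cons.IH[OF v lt this] obtain js where
      js: "is_word n (transpose (?s a) (?s b) \<circ> v) js" "length js < length is" by blast
    have "transpose (?s a) (?s b) \<circ> v = ?s \<circ> (transpose a b \<circ> u)"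
      by (auto simp: u fun_eq_iff simple_transp_def transpose_def)
    then have "is_word n (transpose a b \<circ> u) (j # js)"
      using js j by (simp add: is_word_Cons)
    then show ?thesis using js(2) by (metis Suc_less_eq length_Cons)
  qed
qed

text \<open>
  If the inequality failed for \<open>v = simple_transp i \<circ> u\<close>, then \<open>transposition_exchange\<close> with the
  transposition of \<open>i\<close> and \<open>i + 1\<close> would give \<open>u\<close> a word that is even shorter than \<open>is\<close>.
\<close>

lemma reduced_word_ConsD:
  assumes "reduced_word n u (i # is)"
  shows "reduced_word n (simple_transp i \<circ> u) is"
    and "i \<in> {1..<n}"
    and "inv (simple_transp i \<circ> u) i < inv (simple_transp i \<circ> u) (i + 1)"
proof -
  let ?v = "simple_transp i \<circ> u"
  have w: "is_word n ?v is" and i: "i \<in> {1..<n}"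
    using assms by (auto simp: reduced_word_def is_arg_min_def is_word_Cons)
  have min: "length (i # is) \<le> length js" if "is_word n u js" for js
    using assms that by (auto simp: reduced_word_def is_arg_min_linorder)
  have ss: "simple_transp i \<circ> ?v = u"
    by (auto simp: simple_transp_def fun_eq_iff)
  have *: "length is \<le> length js" if "is_word n ?v js" for js
    using min[of "i # js"] that i by (simp add: is_word_Cons)
  show "reduced_word n ?v is"
    using w * by (auto simp: reduced_word_def is_arg_min_linorder)
  show "i \<in> {1..<n}" by (fact i)
  have "inv ?v i \<noteq> inv ?v (i + 1)"
    using permutes_bij[OF is_word_permutes[OF w]] by (metis bij_inv_eq_iff n_not_Suc_n Suc_eq_plus1)
  moreover have "\<not> inv ?v (i + 1) < inv ?v i"
  proof
    assume "inv ?v (i + 1) < inv ?v i"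
    from transposition_exchange[OF w _ this] obtain js where
      "is_word n u js" "length js < length is" using ss by (auto simp: simple_transp_def)
    then show False using min by fastforce
  qed
  ultimately show "inv ?v i < inv ?v (i + 1)" by simp
qed

section \<open>The operators at gamma = 0\<close>

interpretation Const: semiring_hom Const by (rule semiring_hom_Const)

interpretation swap: semiring_hom "swap_vars i" for i
  unfolding swap_vars_def by (intro semiring_hom_subst semiring_hom_Const)

lemma swap_vars_Var: "swap_vars i (Var j) = Var (transpose i (i + 1) j)"
  by (simp add: swap_vars_def subst_Var)

lemma swap_vars_Const: "swap_vars i (Const c) = Const c"
  by (simp add: swap_vars_def subst_Const)

abbreviation param_gamma_to_zero :: "int mpoly \<Rightarrow> int mpoly" where
  "param_gamma_to_zero \<equiv> subst Const (Var(2 := 0))"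

interpretation param: semiring_hom param_gamma_to_zero
  by (intro semiring_hom_subst semiring_hom_Const)

interpretation gamma_to_zero: semiring_hom gamma_to_zero
  unfolding gamma_to_zero_def
  by (intro semiring_hom_subst semiring_hom_comp[OF semiring_hom_Const] semiring_hom_Const)

lemma gamma_to_zero_Var: "gamma_to_zero (Var j) = Var j"
  by (simp add: gamma_to_zero_def subst_Var)

lemma gamma_to_zero_Const: "gamma_to_zero (Const c) = Const (param_gamma_to_zero c)"
  by (simp add: gamma_to_zero_def subst_Const)

lemma param_gamma_to_zero_params:
  "param_gamma_to_zero alpha = alpha" "param_gamma_to_zero beta = beta"
  "param_gamma_to_zero gamma = 0"
  by (simp_all add: alpha_def beta_def gamma_def subst_Var)

text \<open>
  Both sides are substitutions into the same polynomial and agree on constants and variables.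
\<close>

lemma gamma_to_zero_swap_vars:
  "gamma_to_zero (swap_vars i p) = swap_vars i (gamma_to_zero p)"
proof -
  have "gamma_to_zero (swap_vars i p) =
      subst (\<lambda>c. gamma_to_zero (Const c)) (\<lambda>j. gamma_to_zero (Var (transpose i (i + 1) j))) p"
    unfolding swap_vars_def by (rule gamma_to_zero.subst)
  moreover have "swap_vars i (gamma_to_zero p) =
      subst (\<lambda>c. swap_vars i (Const (param_gamma_to_zero c))) (\<lambda>j. swap_vars i (Var j)) p"
    unfolding gamma_to_zero_def by (rule swap.subst)
  ultimately show ?thesis
    by (simp add: gamma_to_zero_Const gamma_to_zero_Var swap_vars_Const swap_vars_Var)
qed

lemma T_op_relation:
  "(Var (i + 1) - Var i) * (T_op i f + Const beta * f) =
     (Const (alpha + beta + gamma) * Var i + Const gamma * Var (i + 1) + 1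
        + Const ((beta + gamma) * (alpha + gamma)) * Var i * Var (i + 1)) * (swap_vars i f - f)"
proof -
  have "divided_difference i f * (Var (i + 1) - Var i) = swap_vars i f - f"
    unfolding divided_difference_def by (rule theI'[OF divided_difference_unique])
  then show ?thesis
    unfolding T_op_def by (simp add: mult_ac flip: \<open>_ = swap_vars i f - f\<close>)
qed

text \<open>
  The denominator-free form of the operator, to be compared with \<open>cross_sum\<close>: the weight of turning at
  an ascent is \<open>(1 + \<alpha> x) (1 + \<beta> y)\<close>, that of going straight is \<open>y - x\<close>.
\<close>

lemma T_op_gamma_zero:
  fixes f i
  defines "x \<equiv> Var i :: int mpoly mpoly" and "y \<equiv> Var (i + 1) :: int mpoly mpoly"
    and "a \<equiv> Const alpha" and "b \<equiv> Const beta" and "F \<equiv> gamma_to_zero f"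
  shows "six_vertex.cross_same a b y x * swap_vars i F =
    (1 + a * x) * (1 + b * y) * F + (y - x) * gamma_to_zero (T_op i f)"
proof -
  have "gamma_to_zero ((Var (i + 1) - Var i) * (T_op i f + Const beta * f)) =
     gamma_to_zero ((Const (alpha + beta + gamma) * Var i + Const gamma * Var (i + 1) + 1
        + Const ((beta + gamma) * (alpha + gamma)) * Var i * Var (i + 1)) * (swap_vars i f - f))"
    by (simp only: T_op_relation)
  then have "(y - x) * (gamma_to_zero (T_op i f) + b * F) =
      ((a + b) * x + 1 + b * a * x * y) * (swap_vars i F - F)"
    unfolding gamma_to_zero.mult gamma_to_zero.add
      semiring_hom_diff[OF gamma_to_zero.semiring_hom_axioms] gamma_to_zero_Var gamma_to_zero_Const
      gamma_to_zero_swap_vars param.add param.mult param_gamma_to_zero_params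
    by (simp add: x_def y_def a_def b_def F_def Const.add Const.mult)
  then show ?thesis unfolding six_vertex.cross_same_def by algebra
qed

section \<open>Hecke--Grothendieck polynomials as partition functions\<close>

text \<open>
  Colour \<open>c i\<close> enters row \<open>i\<close>, and colour \<open>n - j\<close> leaves at the top of column \<open>j\<close>, where \<open>j\<close> counts from \<open>0\<close>.
\<close>

definition row_colouring_sum :: "nat \<Rightarrow> (nat \<Rightarrow> nat) \<Rightarrow> int mpoly mpoly" where
  "row_colouring_sum n c = six_vertex.partition_function n (Const alpha) (Const beta)
     (map Var [1..<Suc n]) (map c [1..<Suc n]) (rev [1..<Suc n])"

definition turn_product :: "nat \<Rightarrow> int mpoly mpoly" where
  "turn_product n = (\<Prod>i=1..n. 1 + Const alpha * Var i)"

lemma turn_product_nonzero: "turn_product n \<noteq> 0"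
  by (simp add: turn_product_def one_plus_Var_nonzero)

lemma swap_vars_turn_product:
  assumes "i \<in> {1..<n}"
  shows "swap_vars i (turn_product n) = turn_product n"
proof -
  have "transpose i (i + 1) permutes {1..n}"
    using assms by (intro permutes_swap_id) auto
  then show ?thesis
    unfolding turn_product_def swap.prod swap.add swap.mult swap.one swap_vars_Const swap_vars_Var
    by (rule prod.permute[symmetric, unfolded comp_def])
qed

lemma map_upt_split_adjacent:
  assumes "i \<in> {1..<n}"
  shows "map g [1..<Suc n] = map g [1..<i] @ g i # g (i + 1) # map g [i + 2..<Suc n]"
proof -
  have "[1..<Suc n] = [1..<i] @ i # (i + 1) # [i + 2..<Suc n]"
    using assms upt_add_eq_append[of 1 i "Suc n - i"] by (simp add: upt_conv_Cons del: upt_Suc)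
  then show ?thesis by (simp del: upt_Suc)
qed

lemma map_transpose_upt_split_adjacent:
  assumes "i \<in> {1..<n}"
  shows "map (g \<circ> transpose i (i + 1)) [1..<Suc n]
    = map g [1..<i] @ g (i + 1) # g i # map g [i + 2..<Suc n]"
  unfolding map_upt_split_adjacent[OF assms] by (auto simp: transpose_def)

text \<open>
  The relation of \<open>T_op_gamma_zero\<close>. As the swapped partition function has the variable of row \<open>i + 1\<close> on
  top, the Yang--Baxter equation is applied with \<open>x\<close> and \<open>y\<close> replaced by \<open>x\<^sub>i\<^sub>+\<^sub>1\<close> and \<open>x\<^sub>i\<close>.
\<close>

lemma row_colouring_sum_exchange:
  assumes i: "i \<in> {1..<n}" and c: "c ` {1..n} \<subseteq> {1..n}" "c i < c (i + 1)"
  shows "six_vertex.cross_same (Const alpha) (Const beta) (Var (i + 1)) (Var i)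
      * swap_vars i (row_colouring_sum n c) =
    (1 + Const alpha * Var i) * (1 + Const beta * Var (i + 1)) * row_colouring_sum n c
    + (Var (i + 1) - Var i) * row_colouring_sum n (c \<circ> transpose i (i + 1))"
proof -
  have le: "c i \<le> n" "c (i + 1) \<le> n" using i c(1) by (auto simp: image_subset_iff)
  have "swap_vars i (row_colouring_sum n c) =
      six_vertex.partition_function n (Const alpha) (Const beta)
       (map (Var \<circ> transpose i (i + 1)) [1..<Suc n]) (map c [1..<Suc n]) (rev [1..<Suc n])"
    unfolding row_colouring_sum_def hom_partition_function[OF swap.semiring_hom_axioms]
    by (simp add: swap_vars_Const swap_vars_Var comp_def del: upt_Suc)
  moreover have "six_vertex.cross_same (Const alpha) (Const beta) (Var (i + 1)) (Var i) *
      six_vertex.partition_function n (Const alpha) (Const beta)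
       (map (Var \<circ> transpose i (i + 1)) [1..<Suc n]) (map c [1..<Suc n]) (rev [1..<Suc n])
    = six_vertex.cross_sum (Const alpha) (Const beta) (Var (i + 1)) (Var i)
       (\<lambda>p q. six_vertex.partition_function n (Const alpha) (Const beta)
          (map Var [1..<Suc n]) (map c [1..<i] @ p # q # map c [i + 2..<Suc n]) (rev [1..<Suc n]))
       (c i) (c (i + 1))"
    unfolding map_transpose_upt_split_adjacent[OF i, of Var]
      map_upt_split_adjacent[OF i, of c] map_upt_split_adjacent[OF i, of Var]
    by (rule six_vertex.yang_baxter_partition_function[OF le]) simp
  ultimately show ?thesis
    using c(2) unfolding row_colouring_sum_def
    by (simp only: map_transpose_upt_split_adjacent[OF i, of c] map_upt_split_adjacent[OF i, of c]
        six_vertex.cross_sum_def six_vertex.through_def six_vertex.cross_turn_def if_True mult_1_left)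
       (rule add.commute)
qed

text \<open>
  The product of the \<open>1 + \<alpha> x\<^sub>i\<close> is symmetric, so multiplication by it is compatible with the relation that
  determines \<open>T\<^sub>i f\<close> from \<open>f\<close>.
\<close>

lemma hecke_word_row_colouring_sum:
  assumes "reduced_word n u is"
  shows "turn_product n * gamma_to_zero (foldr (\<lambda>i F. T_op i \<circ> F) is id (\<Prod>i=1..n. Var i ^ (n - i)))
    = row_colouring_sum n (inv u)"
  using assms
proof (induction "is" arbitrary: u)
  case Nil
  then have "u = id" by (simp add: reduced_word_def is_arg_min_def is_word_def)
  then show ?case
    using six_vertex.partition_function_frozen[of 1 n n "Const alpha" "Const beta" Var]
    by (simp add: row_colouring_sum_def turn_product_def gamma_to_zero.prod gamma_to_zero.power
        gamma_to_zero_Var del: upt_Suc)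
next
  case (Cons i "is")
  define v where "v = simple_transp i \<circ> u"
  let ?f = "foldr (\<lambda>i F. T_op i \<circ> F) is id (\<Prod>i=1..n. Var i ^ (n - i))"
  let ?D = "turn_product n" and ?e = gamma_to_zero and ?d = "Var (i + 1) - Var i :: int mpoly mpoly"
  let ?N = "six_vertex.cross_same (Const alpha) (Const beta) (Var (i + 1)) (Var i :: int mpoly mpoly)"
  let ?A = "(1 + Const alpha * Var i) * (1 + Const beta * Var (i + 1)) :: int mpoly mpoly"
  have v: "reduced_word n v is" and i: "i \<in> {1..<n}" and lt: "inv v i < inv v (i + 1)"
    using reduced_word_ConsD[OF Cons.prems] by (simp_all add: v_def)
  have IH: "?D * ?e ?f = row_colouring_sum n (inv v)" by (rule Cons.IH[OF v])
  have perm: "v permutes {1..n}"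
    using v is_word_permutes by (auto simp: reduced_word_def is_arg_min_def)
  have "u = simple_transp i \<circ> v" by (auto simp: v_def simple_transp_def fun_eq_iff)
  then have inv: "inv u = inv v \<circ> transpose i (i + 1)"
    using o_inv_distrib[of "simple_transp i" v] permutes_bij[OF perm]
    by (simp add: simple_transp_def[abs_def])
  have "?d * (?D * ?e (T_op i ?f)) = ?D * (?N * swap_vars i (?e ?f) - ?A * ?e ?f)"
    unfolding T_op_gamma_zero by (simp add: algebra_simps)
  also have "\<dots> = ?N * swap_vars i (?D * ?e ?f) - ?A * (?D * ?e ?f)"
    by (simp add: swap.mult swap_vars_turn_product[OF i] algebra_simps)
  also have "\<dots> = ?d * row_colouring_sum n (inv v \<circ> transpose i (i + 1))"
    unfolding IH using permutes_image[OF permutes_inv[OF perm]] lt i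
    by (subst row_colouring_sum_exchange) auto
  finally have "?D * ?e (T_op i ?f) = row_colouring_sum n (inv v \<circ> transpose i (i + 1))"
    using Var_diff_nonzero[of i, where 'a = "int mpoly"] mult_cancel_left by blast
  moreover have "foldr (\<lambda>i F. T_op i \<circ> F) (i # is) id g = T_op i (foldr (\<lambda>i F. T_op i \<circ> F) is id g)" for g
    by simp
  ultimately show ?case by (simp only: inv)
qed

theorem theorem1p4:
  fixes n :: nat and w :: "nat \<Rightarrow> nat"
  assumes "n \<ge> 1" and "w permutes {1..n}"
  shows "hecke_grothendieck n w \<in> polys_over (polys_over \<nat> {0, 1}) {1..n}"
proof -
  let ?C = "polys_over \<nat> {0, 1} :: int mpoly set"
  let ?P = "polys_over ?C {1..n}"
  have C: "0 \<in> ?C" "1 \<in> ?C" "alpha \<in> ?C" "beta \<in> ?C"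
    "\<And>c d. c \<in> ?C \<Longrightarrow> d \<in> ?C \<Longrightarrow> c + d \<in> ?C" "\<And>c d. c \<in> ?C \<Longrightarrow> d \<in> ?C \<Longrightarrow> c * d \<in> ?C"
    by (simp_all add: zero_in_polys_over one_in_polys_over alpha_def beta_def Var_in_polys_over
        polys_over_add polys_over_mult)
  have "inv w j \<in> {1..n}" if "j \<in> {1..n}" for j
    using that permutes_in_image[OF permutes_inv[OF assms(2)]] by blast
  then have "0 \<notin> set (map (inv w) [1..<Suc n])"
    by (fastforce simp del: upt_Suc)
  moreover have "set (map Var [1..<Suc n]) \<subseteq> ?P"
    using C by (auto intro: Var_in_polys_over simp del: upt_Suc)
  ultimately have "\<exists>p\<in>?P. row_colouring_sum n (inv w) =
      (\<Prod>x\<leftarrow>map Var [1..<Suc n]. 1 + Const alpha * x) * p"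
    unfolding row_colouring_sum_def
    by (intro six_vertex.partition_function_divisible)
       (simp_all add: C zero_in_polys_over one_in_polys_over polys_over_add polys_over_mult
          Const_in_polys_over del: upt_Suc One_nat_def)
  moreover have "(\<Prod>x\<leftarrow>map Var [1..<Suc n]. 1 + Const alpha * x) = turn_product n"
    unfolding turn_product_def
    using prod.distinct_set_conv_list[of "[1..<Suc n]" "\<lambda>i. 1 + Const alpha * (Var i :: int mpoly mpoly)"]
    by (simp add: comp_def atLeastLessThanSuc_atLeastAtMost del: upt_Suc)
  ultimately obtain p where p: "p \<in> ?P" "row_colouring_sum n (inv w) = turn_product n * p"
    by auto
  have "turn_product n * hecke_grothendieck n w = row_colouring_sum n (inv w)"
    unfolding hecke_grothendieck_def KN_def T_perm_def
    by (rule hecke_word_row_colouring_sum) (rule someI_ex[OF reduced_word_exists[OF assms(2)]])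
  then show ?thesis using p turn_product_nonzero by simp
qed

end
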